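(* For every graph $G$ and every 2-switch $\tau$ on $G$, $|\omega(\tau(G))-\omega(G)|\le 1$, where $\omega$ denotes the clique number.
   Context: Graphs are finite and simple. A 2-switch on $G$ is specified by four distinct vertices $a,b,c,d$ with $ab,cd\in E(G)$ and $ac,bd\notin E(G)$; it produces $\tau(G)=G-ab-cd+ac+bd$. $\omega(G)$ is the maximum size of a set of pairwise adjacent vertices of $G$. *)

theory Defs
  imports "HOL-Library.Ramsey"
begin

definition simple_graph :: "'a set \<Rightarrow> 'a set set \<Rightarrow> bool" where
  "simple_graph V E \<longleftrightarrow> finite V \<and> (\<forall>e\<in>E. e \<subseteq> V \<and> card e = 2)"

definition is_two_switch :: "'a set set \<Rightarrow> 'a \<Rightarrow> 'a \<Rightarrow> 'a \<Rightarrow> 'a \<Rightarrow> bool" where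
  "is_two_switch E a b c d \<longleftrightarrow>
     distinct [a, b, c, d] \<and> {a, b} \<in> E \<and> {c, d} \<in> E \<and> {a, c} \<notin> E \<and> {b, d} \<notin> E"

text \<open>A 2-switch leaves the vertex set unchanged, so only the new edge set is given.\<close>

definition two_switch :: "'a set set \<Rightarrow> 'a \<Rightarrow> 'a \<Rightarrow> 'a \<Rightarrow> 'a \<Rightarrow> 'a set set" where
  "two_switch E a b c d = (E - {{a, b}, {c, d}}) \<union> {{a, c}, {b, d}}"

text \<open>For finite \<open>V\<close> the maximum is over a finite set, which contains \<open>0\<close> because the
  empty set is a clique.\<close>

definition clique_number :: "'a set \<Rightarrow> 'a set set \<Rightarrow> nat" where
  "clique_number V E = Max {card K | K. K \<subseteq> V \<and> clique K E}"

lemma simple_graph_two_switch: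
  assumes "simple_graph V E" "is_two_switch E a b c d"
  shows "simple_graph V (two_switch E a b c d)"
proof -
  have "{a, b} \<subseteq> V" "{c, d} \<subseteq> V"
    using assms unfolding simple_graph_def is_two_switch_def by blast+
  moreover have "card {a, c} = 2" "card {b, d} = 2"
    using assms unfolding is_two_switch_def by auto
  ultimately show ?thesis
    using assms unfolding simple_graph_def two_switch_def by auto
qed

end

theory Submission
  imports Defs
begin

text \<open>A clique containing both switched edges \<open>ab\<close> and \<open>cd\<close> would contain the non-edge \<open>ac\<close>, so
  deleting one vertex from a clique of \<open>G\<close> gives a clique of \<open>\<tau>(G)\<close>. The reverse inequality
  follows because \<open>\<tau>\<close> is undone by another 2-switch.\<close>

lemma finite_clique_cards:
  assumes "finite V"
  shows "finite {card K | K. K \<subseteq> V \<and> clique K E}"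
  using assms by simp

lemma card_le_clique_number:
  assumes "finite V" "K \<subseteq> V" "clique K E"
  shows "card K \<le> clique_number V E"
  unfolding clique_number_def using assms by (intro Max_ge) auto

lemma clique_number_attained:
  fixes V :: "'a set"
  assumes "finite V"
  obtains K where "K \<subseteq> V" "clique K E" "card K = clique_number V E"
proof -
  have "card ({} :: 'a set) \<in> {card K | K. K \<subseteq> V \<and> clique K E}"
    unfolding clique_def by blast
  then have "clique_number V E \<in> {card K | K. K \<subseteq> V \<and> clique K E}"
    unfolding clique_number_def using finite_clique_cards[OF assms] Max_in by blast
  then show ?thesis
    using that by auto
qed

text \<open>Undoing the switch exchanges the roles of \<open>b\<close> and \<open>c\<close>: the new
  edges \<open>ac\<close>, \<open>bd\<close> are removed, and \<open>ab\<close>, \<open>cd\<close>,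
  which are non-edges after the first switch, come back.\<close>

lemma is_two_switch_reverse:
  assumes "is_two_switch E a b c d"
  shows "is_two_switch (two_switch E a b c d) a c b d"
  using assms unfolding is_two_switch_def two_switch_def by (auto simp: doubleton_eq_iff)

lemma two_switch_reverse:
  assumes "is_two_switch E a b c d"
  shows "two_switch (two_switch E a b c d) a c b d = E"
  using assms unfolding is_two_switch_def two_switch_def by (auto simp: doubleton_eq_iff)

text \<open>Only the pairs \<open>ab\<close> and \<open>cd\<close> lose adjacency, and
  \<open>K\<close> contains at most one of them, so deleting one end of that pair suffices. The
  vertex \<open>v\<close> need not lie in \<open>K\<close>.\<close>

lemma clique_two_switch_minus_vertex:
  assumes "is_two_switch E a b c d" "clique K E"
  obtains v where "clique (K - {v}) (two_switch E a b c d)"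
proof (cases "{a, b} \<subseteq> K")
  case True
  \<comment> \<open>Since \<open>ac\<close> is a non-edge, \<open>cd\<close> is not inside
    \<open>K\<close>, and only \<open>ab\<close> has to be broken.\<close>
  then have "c \<notin> K"
    using assms unfolding is_two_switch_def clique_def by auto
  then have "clique (K - {a}) (two_switch E a b c d)"
    using assms unfolding clique_def two_switch_def by (auto simp: doubleton_eq_iff)
  then show ?thesis by (rule that)
next
  case False
  \<comment> \<open>Here at most \<open>cd\<close> is lost inside \<open>K\<close>, and deleting
    \<open>c\<close> breaks it.\<close>
  then have "clique (K - {c}) (two_switch E a b c d)"
    using assms unfolding clique_def two_switch_def by (auto simp: doubleton_eq_iff)
  then show ?thesis by (rule that)
qed

lemma clique_number_le_two_switch:
  assumes "finite V" "is_two_switch E a b c d"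
  shows "clique_number V E \<le> clique_number V (two_switch E a b c d) + 1"
proof -
  obtain K where K: "K \<subseteq> V" "clique K E" "card K = clique_number V E"
    using clique_number_attained[OF assms(1)] .
  obtain v where "clique (K - {v}) (two_switch E a b c d)"
    using clique_two_switch_minus_vertex[OF assms(2) K(2)] .
  then have "card (K - {v}) \<le> clique_number V (two_switch E a b c d)"
    using assms(1) K(1) by (intro card_le_clique_number) auto
  \<comment> \<open>Only an inequality, because \<open>v\<close> may lie outside
    \<open>K\<close>.\<close>
  moreover have "card K \<le> card (K - {v}) + 1"
    by (auto simp: card_Diff_singleton_if)
  ultimately show ?thesis
    using K(3) by linarith
qed

theorem mainTheorem12:
  fixes V :: "'a set" and E :: "'a set set" and a b c d :: 'a
  assumes "simple_graph V E"
    and "is_two_switch E a b c d"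
  shows "\<bar>int (clique_number V (two_switch E a b c d)) - int (clique_number V E)\<bar> \<le> 1"
proof -
  have "finite V"
    using assms(1) unfolding simple_graph_def by blast
  then show ?thesis
    using clique_number_le_two_switch[OF _ assms(2)]
      \<comment> \<open>The same bound for the reverse switch, starting from the switched graph,
        gives the other inequality.\<close>
      clique_number_le_two_switch[OF _ is_two_switch_reverse[OF assms(2)]]
    unfolding two_switch_reverse[OF assms(2)] by fastforce
qed

end
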